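(* Let $\mathcal{C}_0$ be a self-orthogonal code over $I_5$ of length $n$ with generator matrix $G_0=(\mathbf{r}_i)$, where $\mathbf{r}_i$ is the $i$th row of $G_0$ for $i=1,2,\dots,m$. Let $\mathbf{x}\in\mathbb{F}_5^n$ and $\alpha,\beta,\gamma,\delta,\varepsilon\in I_5$, not all zero, such that $\alpha+\beta+\gamma+\delta+\varepsilon=0$. Let $\iota,\kappa,\lambda,\mu,\nu\in J=\{0,\mathtt{b},2\mathtt{b},3\mathtt{b},4\mathtt{b}\}$, not all zero, such that $\iota+\kappa+\lambda+\mu+\nu=0$. Then the code $\mathcal{C}$ over $I_5$ with generator matrix $$G=\left(\begin{array}{ccccc|c} \alpha&\beta&\gamma&\delta&0&\varepsilon\mathbf{x}\\ 0&\iota&\kappa&\lambda&\mu&\nu\mathbf{x}\\ \hline (\mathbf{x},\mathbf{r}_1)&(\mathbf{x},\mathbf{r}_1)&(\mathbf{x},\mathbf{r}_1)&(\mathbf{x},\mathbf{r}_1)&(\mathbf{x},\mathbf{r}_1)&\mathbf{r}_1\\ \vdots&\vdots&\vdots&\vdots&\vdots&\vdots\\ (\mathbf{x},\mathbf{r}_m)&(\mathbf{x},\mathbf{r}_m)&(\mathbf{x},\mathbf{r}_m)&(\mathbf{x},\mathbf{r}_m)&(\mathbf{x},\mathbf{r}_m)&\mathbf{r}_m\end{array}\right)$$ is a self-orthogonal code of length $n+5$ if one of the following conditions is satisfied (where $(\mathbf{x},\mathbf{x})\in\mathbb{F}_5$): (i) $(\mathbf{x},\mathbf{x})=1$ and $\alpha^2+\beta^2+\gamma^2+\delta^2+\varepsilon^2=0$;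 (ii) $(\mathbf{x},\mathbf{x})=2$ and $\alpha^2+\beta^2+\gamma^2+\delta^2+2\varepsilon^2=0$; (iii) $(\mathbf{x},\mathbf{x})=3$ and $\alpha^2+\beta^2+\gamma^2+\delta^2+3\varepsilon^2=0$; or (iv) $(\mathbf{x},\mathbf{x})=4$ and $\alpha^2+\beta^2+\gamma^2+\delta^2+4\varepsilon^2=0$.
   Context: $I_5$ is the commutative ring without unity of order 25 and characteristic 5 generated by $\mathtt{a},\mathtt{b}$ with relations $5\mathtt{a}=5\mathtt{b}=0$, $\mathtt{a}^2=\mathtt{b}$, $\mathtt{a}\mathtt{b}=0$ (hence $\mathtt{b}^2=0$); every element is uniquely $\mathtt{a}x+\mathtt{b}y$ with $x,y\in\mathbb{F}_5$. $J=\{j\mathtt{b}:0\le j<5\}$ is its maximal ideal. $\mathbb{F}_5$ acts naturally on $I_5$ by repeated addition. A linear code of length $n$ over $I_5$ is an $I_5$-submodule of $I_5^n$; the code with generator matrix $G$ is the smallest $I_5$-submodule (additive subgroup closed under multiplication by $I_5$) containing the rows of $G$. For $\mathbf{x}\in\mathbb{F}_5^n$, $\mathbf{r}\in I_5^n$, $(\mathbf{x},\mathbf{r})=\sum_i x_ir_i\in I_5$; for $\mathbf{y},\mathbf{z}$ both in $I_5^n$ (or both in $\mathbb{F}_5^n$), $(\mathbf{y},\mathbf{z})=\sum_i y_iz_i$. For $\nu\in I_5$ and $\mathbf{x}\in\mathbb{F}_5^n$, $\nu\mathbf{x}=(\nu x_1,\dots,\nu x_n)$. A code $\mathcal{C}$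 is self-orthogonal if $(\mathbf{y},\mathbf{z})=0$ for all $\mathbf{y},\mathbf{z}\in\mathcal{C}$. *)

theory Defs
  imports "HOL-Library.Numeral_Type" "Jordan_Normal_Form.Matrix"
begin

section \<open>The ring \<open>I\<^sub>5\<close>\<close>

text \<open>
  The field with five elements is the library type \<^typ>\<open>5\<close> of integers modulo 5.
  The value \<open>I5 x y\<close> stands for \<open>a x + b y\<close>; the lemmas at the end of this section establish
  the defining relations and the unique representation of elements.
\<close>

datatype I5 = I5 (a_coeff: 5) (b_coeff: 5)

instantiation I5 :: comm_ring
begin

definition "0 = I5 0 0"
definition "r + s = I5 (a_coeff r + a_coeff s) (b_coeff r + b_coeff s)"
definition "- r = I5 (- a_coeff r) (- b_coeff r)"
definition "r - s = I5 (a_coeff r - a_coeff s) (b_coeff r - b_coeff s)"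

text \<open>\<open>(a x + b y) (a x' + b y') = a\<^sup>2 x x' = b x x'\<close>, since \<open>a\<^sup>2 = b\<close> and \<open>a b = b\<^sup>2 = 0\<close>.\<close>
definition "r * s = I5 0 (a_coeff r * a_coeff s)"

instance
  by standard
    (simp_all add: zero_I5_def plus_I5_def uminus_I5_def minus_I5_def times_I5_def algebra_simps)

end

definition I5_a :: I5 where "I5_a = I5 1 0"
definition I5_b :: I5 where "I5_b = I5 0 1"

text \<open>
  Action of the prime field by repeated addition, using the representative in \<open>{0..<5}\<close>. Lemma
  \<open>F5_act_of_nat\<close> below shows that any other nonnegative representative gives the same result.
\<close>

definition F5_act :: "5 \<Rightarrow> I5 \<Rightarrow> I5" (infixr \<open>\<cdot>\<^sub>5\<close> 75) where
  "x \<cdot>\<^sub>5 r = (((+) r) ^^ nat (Rep_bit1 x)) 0"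

definition I5_J :: "I5 set" where
  "I5_J = {j \<cdot>\<^sub>5 I5_b | j. True}"

lemma add_funpow_I5: "(((+) r) ^^ k) 0 = I5 (of_nat k * a_coeff r) (of_nat k * b_coeff r)"
  by (induction k) (simp_all add: zero_I5_def plus_I5_def algebra_simps)

lemma of_nat_Rep_F5: "of_nat (nat (Rep_bit1 x)) = (x :: 5)"
proof -
  have "0 \<le> Rep_bit1 x" using Rep_bit1[of x] by simp
  then show ?thesis
    using bit1.Rep_mod[of x] bit1.Rep_inverse[of x] by (simp add: bit1.of_int_eq)
qed

lemma F5_act_eq: "x \<cdot>\<^sub>5 r = I5 (x * a_coeff r) (x * b_coeff r)"
  by (simp add: F5_act_def add_funpow_I5 of_nat_Rep_F5)

lemma F5_act_of_nat: "of_nat k \<cdot>\<^sub>5 r = (((+) r) ^^ k) 0"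
  by (simp add: F5_act_eq add_funpow_I5)

lemma I5_relations:
  "I5_a * I5_a = I5_b" "I5_a * I5_b = 0" "I5_b * I5_b = 0"
  "(((+) I5_a) ^^ 5) 0 = 0" "(((+) I5_b) ^^ 5) 0 = 0"
proof -
  have "(5 :: 5) = 0"
    by simp
  then show "(((+) I5_a) ^^ 5) 0 = 0" "(((+) I5_b) ^^ 5) 0 = 0"
    unfolding add_funpow_I5 by (simp_all only: of_nat_numeral mult_zero_left zero_I5_def)
qed (simp_all add: I5_a_def I5_b_def times_I5_def zero_I5_def)

lemma I5_unique_rep: "\<exists>!(x, y). r = x \<cdot>\<^sub>5 I5_a + y \<cdot>\<^sub>5 I5_b"
  by (cases r) (auto simp: F5_act_eq I5_a_def I5_b_def plus_I5_def)

lemma card_I5: "CARD(I5) = 25"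
proof -
  have "bij (\<lambda>(x, y). I5 x y)"
    by (rule bijI) (auto simp: inj_def surj_def, metis I5.exhaust)
  then have "CARD(5 \<times> 5) = CARD(I5)"
    by (rule bij_betw_same_card)
  then show ?thesis by simp
qed

lemma I5_no_unit: "\<not> (\<exists>e :: I5. \<forall>r. e * r = r)"
proof
  assume "\<exists>e :: I5. \<forall>r. e * r = r"
  then obtain e :: I5 where "e * I5_a = I5_a" by blast
  then show False by (simp add: times_I5_def I5_a_def)
qed

lemma I5_J_multiples: "I5_J = {(((+) I5_b) ^^ j) 0 | j. j < 5}"
proof -
  have "nat (Rep_bit1 x) < 5" for x :: 5
    using bit1.Rep_less_n[of x] by simp
  then show ?thesis
    unfolding I5_J_def F5_act_of_nat[symmetric] by (force simp: of_nat_Rep_F5)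
qed


section \<open>Linear codes over \<open>I\<^sub>5\<close>\<close>

text \<open>
  As \<open>I\<^sub>5\<close> has no unity, being an additive subgroup and being closed under multiplication
  by scalars are separate requirements.
\<close>

definition linear_code :: "nat \<Rightarrow> I5 vec set \<Rightarrow> bool" where
  "linear_code n C \<longleftrightarrow> C \<subseteq> carrier_vec n \<and> 0\<^sub>v n \<in> C \<and>
    (\<forall>u\<in>C. \<forall>v\<in>C. u + v \<in> C) \<and> (\<forall>u\<in>C. - u \<in> C) \<and> (\<forall>r. \<forall>u\<in>C. r \<cdot>\<^sub>v u \<in> C)"

definition generated_code :: "I5 mat \<Rightarrow> I5 vec set" where
  "generated_code G = \<Inter> {C. linear_code (dim_col G) C \<and> set (rows G) \<subseteq> C}"

lemma linear_code_generated: "linear_code (dim_col G) (generated_code G)"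
proof -
  have "linear_code (dim_col G) (carrier_vec (dim_col G))" "set (rows G) \<subseteq> carrier_vec (dim_col G)"
    by (auto simp: linear_code_def rows_def)
  then have "generated_code G \<subseteq> carrier_vec (dim_col G)"
    unfolding generated_code_def by blast
  then show ?thesis
    unfolding linear_code_def by (auto simp: generated_code_def linear_code_def)
qed

lemma rows_in_generated_code: "set (rows G) \<subseteq> generated_code G"
  by (auto simp: generated_code_def)

definition self_orthogonal :: "I5 vec set \<Rightarrow> bool" where
  "self_orthogonal C \<longleftrightarrow> (\<forall>y\<in>C. \<forall>z\<in>C. y \<bullet> z = 0)"

definition mixed_prod :: "5 vec \<Rightarrow> I5 vec \<Rightarrow> I5" where
  "mixed_prod x r = (\<Sum>i\<in>{0..<dim_vec r}. x $ i \<cdot>\<^sub>5 r $ i)"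

definition scale_F5_vec :: "I5 \<Rightarrow> 5 vec \<Rightarrow> I5 vec" where
  "scale_F5_vec \<nu> x = map_vec (\<lambda>c. c \<cdot>\<^sub>5 \<nu>) x"

end

theory Submission
  imports Defs
begin

text \<open>
  Every product with a factor in \<open>J\<close> vanishes, so the second row of \<open>G\<close> is orthogonal
  to every row. In the first row the tail \<open>\<epsilon>x\<close> pairs with \<open>r\<^sub>i\<close> to \<open>\<epsilon> (x, r\<^sub>i)\<close>, which together with the
  five constant entries gives \<open>(\<alpha> + \<beta> + \<gamma> + \<delta> + \<epsilon>) (x, r\<^sub>i) = 0\<close>. Two lower rows pair to
  \<open>5 (x, r\<^sub>i) (x, r\<^sub>j) + (r\<^sub>i, r\<^sub>j) = 0\<close>, and the first row pairs with itself to
  \<open>\<alpha>\<^sup>2 + \<beta>\<^sup>2 + \<gamma>\<^sup>2 + \<delta>\<^sup>2 + (x, x) \<epsilon>\<^sup>2\<close>.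
\<close>

text \<open>Multiplication only sees the coefficients of \<open>I5_a\<close>, and these are 0 for
  elements of \<open>I5_J\<close>.\<close>

lemma I5_mult_J:
  assumes "s \<in> I5_J"
  shows "r * s = 0" and "s * r = 0"
  using assms by (auto simp: I5_J_def I5_b_def F5_act_eq times_I5_def zero_I5_def)

text \<open>Without a unity in \<open>I5\<close>, scalars of the prime field cannot be replaced by
  ring elements, so their compatibility with the product is recorded separately.\<close>

lemma F5_act_mult_right: "s * (c \<cdot>\<^sub>5 r) = c \<cdot>\<^sub>5 (s * r)"
  and F5_act_mult_left: "(c \<cdot>\<^sub>5 s) * r = c \<cdot>\<^sub>5 (s * r)"
  and F5_act_F5_act: "c \<cdot>\<^sub>5 (d \<cdot>\<^sub>5 r) = (c * d) \<cdot>\<^sub>5 r"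
  by (simp_all add: F5_act_eq times_I5_def algebra_simps)

lemma F5_act_add_left: "(c + d) \<cdot>\<^sub>5 r = c \<cdot>\<^sub>5 r + d \<cdot>\<^sub>5 r"
  by (simp add: F5_act_eq plus_I5_def algebra_simps)

lemma F5_act_zero: "0 \<cdot>\<^sub>5 r = 0"
  and F5_act_zero_right: "c \<cdot>\<^sub>5 0 = 0"
  by (simp_all add: F5_act_eq zero_I5_def)

lemma F5_act_sum_left: "sum f A \<cdot>\<^sub>5 r = (\<Sum>i\<in>A. f i \<cdot>\<^sub>5 r)"
  by (induction A rule: infinite_finite_induct) (simp_all add: F5_act_add_left F5_act_zero)

lemma F5_act_one: "1 \<cdot>\<^sub>5 r = r"
  by (simp add: F5_act_eq)

text \<open>Five-fold addition is the action of the residue \<open>5\<close>, which is 0 in the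
  prime field. This cancels the constant heads of two lower rows.\<close>

lemma I5_five_times: "r + r + r + r + r = (0 :: I5)"
proof -
  have "(((+) r) ^^ 5) 0 = (5 :: 5) \<cdot>\<^sub>5 r"
    using F5_act_of_nat[of 5 r] by (simp only: of_nat_numeral)
  moreover have "(5 :: 5) = 0"
    by simp
  ultimately have "(((+) r) ^^ 5) 0 = 0"
    by (simp only: F5_act_zero)
  then show ?thesis
    by (simp add: eval_nat_numeral add.assoc)
qed

lemma scale_F5_vec_scalar_prod:
  assumes "dim_vec x = dim_vec r"
  shows "scale_F5_vec s x \<bullet> r = s * mixed_prod x r"
  using assms by (auto simp: scalar_prod_def scale_F5_vec_def mixed_prod_def sum_distrib_left
      F5_act_mult_left F5_act_mult_right intro!: sum.cong)

lemma scale_F5_vec_scalar_prod_scale: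
  "scale_F5_vec s x \<bullet> scale_F5_vec t x = (x \<bullet> x) \<cdot>\<^sub>5 (s * t)"
  by (simp add: scalar_prod_def scale_F5_vec_def F5_act_mult_left F5_act_mult_right
      F5_act_F5_act F5_act_sum_left)

lemma row_mat_of_rows_list:
  assumes "i < length rs" and "length (rs ! i) = nc"
  shows "row (mat_of_rows_list nc rs) i = vec_of_list (rs ! i)"
  using assms by (auto simp: mat_of_rows_list_def vec_of_list_index)

text \<open>Linearity of the product in its second argument makes the orthogonal of \<open>S\<close>
  a code, so it can enter the intersection that defines \<open>generated_code\<close>.\<close>

lemma linear_code_orthogonal:
  assumes "S \<subseteq> carrier_vec n"
  shows "linear_code n {v \<in> carrier_vec n. \<forall>u\<in>S. u \<bullet> v = 0}"
  unfolding linear_code_def using assms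
  by (auto simp: subset_iff scalar_prod_add_distrib[where n = n])

text \<open>Passing to the orthogonal of a set twice, first of the rows and then of the whole code,
  reduces self-orthogonality to the generators.\<close>

lemma self_orthogonal_generated_code:
  assumes "\<And>u v. u \<in> set (rows G) \<Longrightarrow> v \<in> set (rows G) \<Longrightarrow> u \<bullet> v = 0"
  shows "self_orthogonal (generated_code G)"
proof -
  let ?n = "dim_col G"
  let ?P = "\<lambda>S. {v \<in> carrier_vec ?n. \<forall>u\<in>S. u \<bullet> v = 0}"
  have minimal: "generated_code G \<subseteq> ?P S"
    if "S \<subseteq> carrier_vec ?n" "set (rows G) \<subseteq> ?P S" for S
    using that linear_code_orthogonal[of S ?n] by (auto simp: generated_code_def)
  have rows: "set (rows G) \<subseteq> carrier_vec ?n"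
    by (auto simp: rows_def)
  have code: "generated_code G \<subseteq> carrier_vec ?n"
    using linear_code_generated[of G] by (simp add: linear_code_def)
  have 1: "generated_code G \<subseteq> ?P (set (rows G))"
    using rows assms by (intro minimal) (auto simp: subset_iff)
  \<comment> \<open>Symmetry of the product turns the previous inclusion around, so minimality
    applies again, now with the whole code in the place of the rows.\<close>
  have "set (rows G) \<subseteq> ?P (generated_code G)"
    using 1 rows code by (auto simp: comm_scalar_prod[of _ ?n] subset_iff)
  then have "generated_code G \<subseteq> ?P (generated_code G)"
    using code by (intro minimal) auto
  then show ?thesis
    by (auto simp: self_orthogonal_def)
qed

theorem theorem3p4:
  fixes n m :: nat
    and C\<^sub>0 :: "I5 vec set" and G\<^sub>0 G :: "I5 mat" and x :: "5 vec"
    and \<alpha> \<beta> \<gamma> \<delta> \<epsilon> \<iota> \<kappa> lam \<mu> \<nu> :: I5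
  assumes "linear_code n C\<^sub>0" and "self_orthogonal C\<^sub>0"
    and "G\<^sub>0 \<in> carrier_mat m n" and "C\<^sub>0 = generated_code G\<^sub>0"
    and "x \<in> carrier_vec n"
    and "\<not> (\<alpha> = 0 \<and> \<beta> = 0 \<and> \<gamma> = 0 \<and> \<delta> = 0 \<and> \<epsilon> = 0)"
    and "\<alpha> + \<beta> + \<gamma> + \<delta> + \<epsilon> = 0"
    and "\<iota> \<in> I5_J" and "\<kappa> \<in> I5_J" and "lam \<in> I5_J" and "\<mu> \<in> I5_J" and "\<nu> \<in> I5_J"
    and "\<not> (\<iota> = 0 \<and> \<kappa> = 0 \<and> lam = 0 \<and> \<mu> = 0 \<and> \<nu> = 0)"
    and "\<iota> + \<kappa> + lam + \<mu> + \<nu> = 0"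
    and "G = four_block_mat
           (mat_of_rows_list 5 [[\<alpha>, \<beta>, \<gamma>, \<delta>, 0], [0, \<iota>, \<kappa>, lam, \<mu>]])
           (mat_of_rows n [scale_F5_vec \<epsilon> x, scale_F5_vec \<nu> x])
           (mat m 5 (\<lambda>(i, j). mixed_prod x (row G\<^sub>0 i)))
           G\<^sub>0"
    and "(x \<bullet> x = 1 \<and> \<alpha> * \<alpha> + \<beta> * \<beta> + \<gamma> * \<gamma> + \<delta> * \<delta> + \<epsilon> * \<epsilon> = 0) \<or>
         (x \<bullet> x = 2 \<and> \<alpha> * \<alpha> + \<beta> * \<beta> + \<gamma> * \<gamma> + \<delta> * \<delta> + 2 \<cdot>\<^sub>5 (\<epsilon> * \<epsilon>) = 0) \<or>
         (x \<bullet> x = 3 \<and> \<alpha> * \<alpha> + \<beta> * \<beta> + \<gamma> * \<gamma> + \<delta> * \<delta> + 3 \<cdot>\<^sub>5 (\<epsilon> * \<epsilon>) = 0) \<or>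
         (x \<bullet> x = 4 \<and> \<alpha> * \<alpha> + \<beta> * \<beta> + \<gamma> * \<gamma> + \<delta> * \<delta> + 4 \<cdot>\<^sub>5 (\<epsilon> * \<epsilon>) = 0)"
  shows "linear_code (n + 5) (generated_code G) \<and> self_orthogonal (generated_code G)"
proof -
  note x = assms(5) and G0 = assms(3) and G = assms(15)
  let ?A = "mat_of_rows_list 5 [[\<alpha>, \<beta>, \<gamma>, \<delta>, 0], [0, \<iota>, \<kappa>, lam, \<mu>]]"
  let ?B = "mat_of_rows n [scale_F5_vec \<epsilon> x, scale_F5_vec \<nu> x]"
  let ?C = "mat m 5 (\<lambda>(i, j). mixed_prod x (row G\<^sub>0 i))"
  \<comment> \<open>Each row is split into a head of length 5 and a tail of length \<open>n\<close>,
    whose products are computed separately.\<close>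
  define p where "p = vec_of_list [\<alpha>, \<beta>, \<gamma>, \<delta>, 0] @\<^sub>v scale_F5_vec \<epsilon> x"
  define q where "q = vec_of_list [0, \<iota>, \<kappa>, lam, \<mu>] @\<^sub>v scale_F5_vec \<nu> x"
  define R where "R r = vec 5 (\<lambda>_. mixed_prod x r) @\<^sub>v r" for r
  have scale: "scale_F5_vec s x \<in> carrier_vec n" for s
    using x by (simp add: scale_F5_vec_def)
  have blocks: "?A \<in> carrier_mat 2 5" "?B \<in> carrier_mat 2 n" "?C \<in> carrier_mat m 5"
    by (auto simp: mat_of_rows_list_def)
  have dims: "dim_row G = m + 2" "dim_col G = n + 5"
    using G0 by (auto simp: G mat_of_rows_list_def)
  have row_p: "row G 0 = p" and row_q: "row G 1 = q"
    unfolding G p_def q_def using row_four_block_mat(1)[OF blocks G0] scale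
    by (simp_all add: row_mat_of_rows_list)
  \<comment> \<open>Two rows lie above the lower blocks, hence the shift by 2.\<close>
  have row_R: "row G (i + 2) = R (row G\<^sub>0 i)" if "i < m" for i
  proof -
    have "row ?C i = vec 5 (\<lambda>_. mixed_prod x (row G\<^sub>0 i))"
      using that by (intro eq_vecI) simp_all
    then show ?thesis
      unfolding G R_def using row_four_block_mat(2)[OF blocks G0, of "i + 2"] that by simp
  qed
  have row_cases: "u = p \<or> u = q \<or> (\<exists>r \<in> set (rows G\<^sub>0). u = R r)" if u: "u \<in> set (rows G)" for u
  proof -
    obtain k where k: "k < dim_row G" "u = row G k"
      using u by (auto simp: rows_def)
    consider "k = 0" | "k = 1" | i where "k = i + 2"
      by (metis One_nat_def Suc_1 add_2_eq_Suc' not0_implies_Suc)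
    then show ?thesis
    proof cases
      case 3
      then have "i < m"
        using k(1) dims(1) by simp
      then have "row G\<^sub>0 i \<in> set (rows G\<^sub>0)"
        using G0 by (simp add: rows_def)
      with \<open>i < m\<close> show ?thesis
        using k(2) 3 row_R[of i] by blast
    qed (use k(2) row_p row_q in simp_all)
  qed
  have rows0: "r \<in> carrier_vec n" if "r \<in> set (rows G\<^sub>0)" for r
    using that G0 by (auto simp: rows_def)
  have app: "(u @\<^sub>v v) \<bullet> (u' @\<^sub>v v') = u \<bullet> u' + v \<bullet> v'"
    if "u \<in> carrier_vec 5" "u' \<in> carrier_vec 5" "v \<in> carrier_vec n" "v' \<in> carrier_vec n"
    for u u' v v' :: "I5 vec"
    using that(1,3,2,4) by (rule scalar_prod_append)
  have list5: "vec_of_list [c0, c1, c2, c3, c4] \<in> carrier_vec 5" for c0 c1 c2 c3 c4 :: I5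
    by (intro carrier_vecI) simp
  have const5: "vec 5 (\<lambda>_. c) \<in> carrier_vec 5" for c :: I5
    by simp
  have head: "vec_of_list [c0, c1, c2, c3, c4] \<bullet> vec_of_list [d0, d1, d2, d3, d4] =
      c0 * d0 + c1 * d1 + c2 * d2 + c3 * d3 + c4 * d4"
    for c0 c1 c2 c3 c4 d0 d1 d2 d3 d4 :: I5
    by (simp add: scalar_prod_def vec_of_list_index eval_nat_numeral)
  have head_const: "vec_of_list [c0, c1, c2, c3, c4] \<bullet> vec 5 (\<lambda>_. c) =
      (c0 + c1 + c2 + c3 + c4) * c" for c0 c1 c2 c3 c4 c :: I5
    by (simp add: scalar_prod_def vec_of_list_index eval_nat_numeral algebra_simps)
  have const_const: "vec 5 (\<lambda>_. c) \<bullet> vec 5 (\<lambda>_. d) = 0" for c d :: I5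
    using I5_five_times[of "c * d"] by (simp add: scalar_prod_def eval_nat_numeral add.assoc)
  \<comment> \<open>The tail contributes
    \<open>(x \<bullet> x) \<cdot>\<^sub>5 (\<epsilon> * \<epsilon>)\<close>, so each of the four
    conditions says exactly that head and tail cancel.\<close>
  have pp: "p \<bullet> p = 0"
    using assms(16) scale
    by (auto simp: p_def app list5 head scale_F5_vec_scalar_prod_scale F5_act_one add.assoc)
  \<comment> \<open>Every summand has a factor 0 or a factor in \<open>I5_J\<close>, the tails
    included.\<close>
  have pq: "p \<bullet> q = 0" and qp: "q \<bullet> p = 0" and qq: "q \<bullet> q = 0"
    using assms(8-12) scale
    by (simp_all add: p_def q_def app list5 head scale_F5_vec_scalar_prod_scale I5_mult_J
        F5_act_zero_right)
  have pR: "p \<bullet> R r = 0" if "r \<in> set (rows G\<^sub>0)" for r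
  proof -
    \<comment> \<open>The fifth head entry of \<open>p\<close> is 0; the summand with
      \<open>\<epsilon>\<close> comes from the tail.\<close>
    have "p \<bullet> R r = (\<alpha> + \<beta> + \<gamma> + \<delta> + \<epsilon>) * mixed_prod x r"
      using rows0[OF that] x scale
      by (simp add: p_def R_def app list5 const5 head_const scale_F5_vec_scalar_prod distrib_right
          del: vec_of_list_Cons)
    then show ?thesis
      using assms(7) by simp
  qed
  have qR: "q \<bullet> R r = 0" if "r \<in> set (rows G\<^sub>0)" for r
    using rows0[OF that] x scale assms(8-12)
    by (simp add: q_def R_def app list5 const5 head_const scale_F5_vec_scalar_prod distrib_right
        I5_mult_J del: vec_of_list_Cons)
  have RR: "R r \<bullet> R s = 0" if "r \<in> set (rows G\<^sub>0)" "s \<in> set (rows G\<^sub>0)" for r s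
  proof -
    have "r \<bullet> s = 0"
      using that rows_in_generated_code[of G\<^sub>0] assms(2,4) by (auto simp: self_orthogonal_def)
    then show ?thesis
      using that by (simp add: R_def app const5 rows0 const_const)
  qed
  \<comment> \<open>The common dimension allows symmetry to reduce \<open>R r \<bullet> p\<close>
    and \<open>R r \<bullet> q\<close> to \<open>pR\<close> and \<open>qR\<close>.\<close>
  have carrier: "p \<in> carrier_vec (5 + n)" "q \<in> carrier_vec (5 + n)"
    "r \<in> set (rows G\<^sub>0) \<Longrightarrow> R r \<in> carrier_vec (5 + n)" for r
    unfolding p_def q_def R_def using scale list5 const5 rows0 by (blast intro: append_carrier_vec)+
  have "u \<bullet> v = 0" if "u \<in> set (rows G)" "v \<in> set (rows G)" for u v
    using row_cases[OF that(1)] row_cases[OF that(2)]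
    by (auto simp: pp pq qp qq pR qR RR comm_scalar_prod[OF carrier(3) carrier(1)]
        comm_scalar_prod[OF carrier(3) carrier(2)])
  then have "self_orthogonal (generated_code G)"
    by (rule self_orthogonal_generated_code)
  with linear_code_generated[of G] show ?thesis
    by (simp add: dims)
qed

end
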